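(* Let $n\ge 2$, $\alpha\in(0,1]$, and let $\psi:\mathbb{B}^n\to\mathbb{R}^m$ ($m\ge1$) be a measurable function such that $$(1-|y|^2)^{-1-\alpha}\psi\in L^p(\mathbb{B}^n,d\nu)\quad\text{for some }p>n.$$ Then $G_h[\psi]$ is $\alpha$-Hölder on $\mathbb{B}^n$; that is, there is a constant $C$ such that $|G_h[\psi](x)-G_h[\psi](x')|\leq C|x-x'|^\alpha$ for all $x,x'\in\mathbb{B}^n$.
   Context: $\mathbb{B}^n$ is the open unit ball of $\mathbb{R}^n$. $\nu$ is Lebesgue measure on $\mathbb{B}^n$ normalized so that $\nu(\mathbb{B}^n)=1$, and $d\tau(x)=(1-|x|^2)^{-n}\,d\nu(x)$. The hyperbolic Green function is $G_h(x,y)=g\left(\frac{|x-y|}{[x,y]}\right)$, where $[x,y]=\sqrt{1+|x|^2|y|^2-2\langle x,y\rangle}$ and $$g(r)=\int_r^1\frac{(1-t^2)^{n-2}}{t^{n-1}}\,dt,\qquad 0<r<1.$$ The hyperbolic Green integral is $G_h[\psi](x)=\int_{\mathbb{B}^n}G_h(x,y)\psi(y)\,d\tau(y)$. For $\alpha=1$, "$\alpha$-Hölder" means Lipschitz. *)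

theory Defs
  imports "HOL-Analysis.Analysis"
begin

text \<open>Both measures below have the open unit ball, with its Lebesgue measurable subsets, as
  underlying space; the first one is normalised to total mass \<open>1\<close>.\<close>

definition ball_nu :: "'a::euclidean_space measure" where
  "ball_nu = uniform_measure (lebesgue_on (ball 0 1)) (ball 0 1)"

definition ball_tau :: "'a::euclidean_space measure" where
  "ball_tau = density ball_nu (\<lambda>x. ennreal (1 / (1 - (norm x)\<^sup>2) ^ DIM('a)))"

definition bracket :: "'a::euclidean_space \<Rightarrow> 'a \<Rightarrow> real" where
  "bracket x y = sqrt (1 + (norm x)\<^sup>2 * (norm y)\<^sup>2 - 2 * (x \<bullet> y))"

text \<open>Only meant for \<open>n \<ge> 2\<close> (the subtractions are on natural numbers) and \<open>0 < r < 1\<close>.\<close>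

definition green_profile :: "nat \<Rightarrow> real \<Rightarrow> real" where
  "green_profile n r = integral {r..1} (\<lambda>t. (1 - t\<^sup>2) ^ (n - 2) / t ^ (n - 1))"

text \<open>On the diagonal, where the classical Green function is infinite, this takes an irrelevant
  real value; for each \<open>x\<close> this concerns a single point \<open>y\<close>, which is a null set.\<close>

definition hyp_green :: "'a::euclidean_space \<Rightarrow> 'a \<Rightarrow> real" where
  "hyp_green x y = green_profile DIM('a) (norm (x - y) / bracket x y)"

definition hyp_green_integral ::
    "('a::euclidean_space \<Rightarrow> 'b::euclidean_space) \<Rightarrow> 'a \<Rightarrow> 'b" where
  "hyp_green_integral \<psi> x = (\<integral>y. hyp_green x y *\<^sub>R \<psi> y \<partial>ball_tau)"

definition in_Lp :: "real \<Rightarrow> 'a measure \<Rightarrow> ('a \<Rightarrow> 'b::euclidean_space) \<Rightarrow> bool" where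
  "in_Lp p M f \<longleftrightarrow> f \<in> borel_measurable M \<and> integrable M (\<lambda>y. norm (f y) powr p)"

end

theory Submission
  imports Defs
begin

text \<open>
  Write \<open>n\<close> for the dimension, \<open>d(x) = 1 - \<bar>x\<bar>\<^sup>2\<close>, \<open>A = [x,y]\<close>, and \<open>f = d powr (-1 - \<alpha>) \<psi>\<close> for the
  function in \<open>L\<^sup>p\<close>. With respect to the normalised Lebesgue measure \<open>\<nu>\<close>, the Green integral of
  \<open>\<psi>\<close> is the integral of \<open>K(x,y) f(y)\<close>, where \<open>K(x,y) = G(x,y) d(y) powr (1 + \<alpha> - n)\<close> is the
  function \<open>hyp_kernel\<close> below.

  The identity \<open>A\<^sup>2 = \<bar>x - y\<bar>\<^sup>2 + d(x) d(y)\<close> gives \<open>1 - s\<^sup>2 = d(x) d(y) / A\<^sup>2\<close> for the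
  pseudo-hyperbolic distance \<open>s = \<bar>x - y\<bar> / A\<close>, so that an elementary bound for the profile of the
  Green function yields \<open>G(x,y) \<le> (d(x) d(y) / (A \<bar>x - y\<bar>)) ^ (n - 1)\<close>. Likewise, the \<open>x\<close>-gradient of
  \<open>G\<close> is at most \<open>d(x) ^ (n - 2) d(y) ^ (n - 1) / (A \<bar>x - y\<bar>) ^ (n - 1)\<close>. Since \<open>d(x)\<close> and \<open>d(y)\<close> are
  both at most \<open>2 A\<close> and \<open>\<alpha> \<le> 1 \<le> n - 1\<close>, the factors \<open>A\<close> can be traded for powers of \<open>d(x)\<close>
  (\<open>weight_balance\<close>): up to constants, \<open>K(x,y)\<close> is at most \<open>d(x) powr \<alpha> / \<bar>x - y\<bar> ^ (n - 1)\<close>, and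
  its gradient at most \<open>d(x) powr (\<alpha> - 1) / \<bar>x - y\<bar> ^ (n - 1)\<close>.

  As in the lemma of Hardy and Littlewood, these two bounds give a Hoelder estimate for \<open>K\<close>
  (\<open>hyp_kernel_holder\<close>): one uses the gradient if \<open>\<bar>x - x'\<bar>\<close> is small compared with \<open>d(x)\<close>, and the
  size of both terms otherwise. The result is \<open>\<bar>x - x'\<bar> powr \<alpha>\<close> times the sum of the two singular
  factors \<open>\<bar>x - y\<bar> powr (1 - n)\<close> and \<open>\<bar>x' - y\<bar> powr (1 - n)\<close>. Integrated against \<open>\<bar>f\<bar>\<close>, these become
  Riesz potentials. They are bounded uniformly in \<open>x\<close> (\<open>riesz_potential_bounded\<close>) because
  \<open>p > n\<close> makes the kernel integrable to the conjugate power.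
\<close>

section \<open>The normalised measure on the ball\<close>

lemma id_measurable_lebesgue_on: "(\<lambda>y::'a::euclidean_space. y) \<in> borel_measurable (lebesgue_on S)"
  by (intro measurable_restrict_space1 measurable_completion) simp

lemma space_ball_nu [simp]: "space (ball_nu :: 'a::euclidean_space measure) = ball 0 1"
  and sets_ball_nu [simp, measurable_cong]:
    "sets (ball_nu :: 'a::euclidean_space measure) = sets (lebesgue_on (ball 0 1))"
  by (simp_all add: ball_nu_def uniform_measure_def)

lemma emeasure_lebesgue_on_unit_ball:
  "emeasure (lebesgue_on (ball 0 1)) (ball (0::'a::euclidean_space) 1)
     = ennreal (unit_ball_vol (real DIM('a)))"
  by (subst emeasure_restrict_space) (auto simp: emeasure_ball)

text \<open>Because \<open>\<nu>\<close> gives the unit ball mass \<open>1\<close>, scaling gives a ball of radius \<open>r\<close> mass exactly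
  \<open>r ^ n\<close> before it is cut off. The independence of the centre is the source of all uniformity in
  \<open>x\<close> below.\<close>

lemma emeasure_ball_nu_ball_le:
  fixes x :: "'a::euclidean_space"
  assumes "0 \<le> r"
  shows "emeasure ball_nu (ball x r \<inter> ball 0 1) \<le> ennreal (r ^ DIM('a))"
proof -
  have v: "0 < unit_ball_vol (real DIM('a))" by (intro unit_ball_vol_pos) simp
  have sets: "ball x r \<inter> ball 0 1 \<in> sets (lebesgue_on (ball (0::'a) 1))"
    by (auto simp: sets_restrict_space)
  have "emeasure (lebesgue_on (ball 0 1)) (ball x r \<inter> ball 0 1) \<le> emeasure lebesgue (ball x r)"
    by (subst emeasure_restrict_space) (auto intro!: emeasure_mono)
  also have "\<dots> = ennreal (unit_ball_vol (real DIM('a)) * r ^ DIM('a))"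
    using assms by (simp add: emeasure_ball)
  finally have le: "emeasure (lebesgue_on (ball 0 1)) (ball x r \<inter> ball 0 1)
      \<le> ennreal (unit_ball_vol (real DIM('a)) * r ^ DIM('a))" .
  have "emeasure ball_nu (ball x r \<inter> ball 0 1)
     = emeasure (lebesgue_on (ball 0 1)) (ball x r \<inter> ball 0 1) / ennreal (unit_ball_vol (real DIM('a)))"
    unfolding ball_nu_def using sets
    by (subst emeasure_uniform_measure) (auto simp: emeasure_lebesgue_on_unit_ball Int_absorb1 sets_restrict_space)
  also have "\<dots> \<le> ennreal (unit_ball_vol (real DIM('a)) * r ^ DIM('a)) / ennreal (unit_ball_vol (real DIM('a)))"
    using le by (rule divide_right_mono_ennreal)
  also have "\<dots> = ennreal (r ^ DIM('a))"
    using v assms by (subst divide_ennreal) (auto simp del: unit_ball_vol_pos)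
  finally show ?thesis .
qed

lemma AE_ball_nu_not_singleton: "AE y in ball_nu. y \<noteq> (x::'a::euclidean_space)"
proof -
  have "AE y in lebesgue. y \<noteq> x"
    by (intro AE_completion AE_lborel_singleton)
  then have "AE y in lebesgue_on (ball 0 1). y \<noteq> x"
    by (subst AE_restrict_space_iff) auto
  then show ?thesis
    unfolding ball_nu_def by (intro AE_uniform_measureI) (auto simp: sets_restrict_space)
qed

section \<open>Uniform bounds for the Riesz potential\<close>

lemma obtain_dyadic_scale:
  fixes t :: real
  assumes "0 < t" "t < 2"
  obtains k :: nat where "(1/2) ^ k \<le> t" "t < 2 * (1/2) ^ k"
proof -
  have "(1/2::real) < 1" by simp
  from real_arch_pow_inv[OF assms(1) this] obtain m where m: "(1/2) ^ m < t" by blast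
  define k where "k = (LEAST k. (1/2) ^ k \<le> t)"
  have k: "(1/2) ^ k \<le> t" 
    unfolding k_def using LeastI[of "\<lambda>k. (1/2) ^ k \<le> t" m] m by simp
  have "t < 2 * (1/2) ^ k"
  proof (cases k)
    case (Suc j)
    then have "\<not> (1/2) ^ j \<le> t" using not_less_Least[of j "\<lambda>k. (1/2) ^ k \<le> t"] k_def by simp
    then show ?thesis using Suc by simp
  qed (use assms in simp)
  with k that show thesis by blast
qed

text \<open>The singularity \<open>\<bar>x - y\<bar> powr -s\<close> is replaced by the dyadic majorant
  \<open>\<Sum>k. 2 powr (s * k)\<close> on the balls of radius \<open>2 * (1/2) ^ k\<close> around \<open>x\<close>. The \<open>k\<close>-th term has
  integral at most \<open>2 ^ n * (2 powr (s - n)) ^ k\<close>, a geometric series for \<open>s < n\<close>. Radius \<open>2\<close> at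
  \<open>k = 0\<close> is enough since two points of the unit ball have distance below \<open>2\<close>.\<close>

lemma nn_integral_riesz_le:
  fixes s :: real
  assumes "0 \<le> s" "s < real DIM('a)"
  obtains M :: real where "0 \<le> M"
    "\<And>x::'a::euclidean_space. x \<in> ball 0 1 \<Longrightarrow>
       (\<integral>\<^sup>+y. ennreal (norm (x - y) powr (- s)) \<partial>ball_nu) \<le> ennreal M"
proof
  define q where "q = 2 powr (s - real DIM('a))"
  have q: "0 < q" "q < 1" using assms by (auto simp: q_def powr_less_one)
  define M where "M = 2 ^ DIM('a) * (\<Sum>k. q ^ k)"
  show "0 \<le> M" using q by (auto simp: M_def intro!: mult_nonneg_nonneg suminf_nonneg)
  fix x :: 'a assume x: "x \<in> ball 0 1"
  define B :: "nat \<Rightarrow> 'a set" where "B k = ball x (2 * (1/2) ^ k) \<inter> ball 0 1" for k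
  have B [measurable]: "B k \<in> sets (lebesgue_on (ball 0 1))" for k
    by (auto simp: sets_restrict_space B_def)
  have pt: "ennreal (norm (x - y) powr (- s)) \<le> (\<Sum>k. ennreal ((2 powr s) ^ k) * indicator (B k) y)"
    if y: "y \<in> ball 0 1" for y
  proof (cases "y = x")
    case False
    have "norm (x - y) < 2" using norm_triangle_ineq4[of x y] x y by simp
    then obtain k where k: "(1/2) ^ k \<le> norm (x - y)" "norm (x - y) < 2 * (1/2) ^ k"
      using obtain_dyadic_scale[of "norm (x - y)"] False by auto
    have "norm (x - y) powr (- s) \<le> ((1/2) ^ k) powr (- s)"
      using k(1) assms by (intro powr_mono2') auto
    also have "\<dots> = (2 powr s) ^ k"
      by (simp add: powr_minus powr_divide powr_realpow[symmetric] powr_powr mult.commute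
          inverse_eq_divide power_one_over)
    finally have "ennreal (norm (x - y) powr (- s)) \<le> ennreal ((2 powr s) ^ k) * indicator (B k) y"
      using k y by (simp add: B_def dist_norm ennreal_leI)
    also have "\<dots> \<le> (\<Sum>k. ennreal ((2 powr s) ^ k) * indicator (B k) y)"
    proof -
      define F where "F = (\<lambda>k. ennreal ((2 powr s) ^ k) * indicator (B k) y)"
      have "F k \<le> suminf F" using sum_le_suminf[OF summableI, of "{k}" F] by simp
      then show ?thesis by (simp only: F_def)
    qed
    finally show ?thesis .
  qed simp
  have "(\<integral>\<^sup>+y. ennreal (norm (x - y) powr (- s)) \<partial>ball_nu)
      \<le> (\<integral>\<^sup>+y. (\<Sum>k. ennreal ((2 powr s) ^ k) * indicator (B k) y) \<partial>ball_nu)"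
    using pt by (intro nn_integral_mono) simp
  also have "\<dots> = (\<Sum>k. \<integral>\<^sup>+y. ennreal ((2 powr s) ^ k) * indicator (B k) y \<partial>ball_nu)"
    by (intro nn_integral_suminf) measurable
  also have "\<dots> = (\<Sum>k. ennreal ((2 powr s) ^ k) * emeasure ball_nu (B k))"
    by (intro suminf_cong nn_integral_cmult_indicator) simp
  also have "\<dots> \<le> (\<Sum>k. ennreal (2 ^ DIM('a) * q ^ k))"
  proof (intro suminf_le summableI)
    fix k
    have "ennreal ((2 powr s) ^ k) * emeasure ball_nu (B k)
        \<le> ennreal ((2 powr s) ^ k) * ennreal ((2 * (1/2) ^ k) ^ DIM('a))"
      unfolding B_def by (rule mult_left_mono[OF emeasure_ball_nu_ball_le]) simp_all
    also have "\<dots> = ennreal (2 ^ DIM('a) * q ^ k)"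
    proof -
      have "(2::real) powr (- real DIM('a)) = (1/2) ^ DIM('a)"
        by (simp add: powr_minus powr_realpow power_one_over inverse_eq_divide)
      then have "((1/2::real) ^ k) ^ DIM('a) = (2 powr (- real DIM('a))) ^ k"
        by (metis power_mult mult.commute)
      moreover have "q ^ k = (2 powr s) ^ k * (2 powr (- real DIM('a))) ^ k"
        by (simp add: q_def power_mult_distrib[symmetric] powr_add[symmetric])
      ultimately show ?thesis by (simp add: ennreal_mult[symmetric] power_mult_distrib)
    qed
    finally show "ennreal ((2 powr s) ^ k) * emeasure ball_nu (B k) \<le> ennreal (2 ^ DIM('a) * q ^ k)" .
  qed
  also have "\<dots> = ennreal M"
    unfolding M_def using q by (subst suminf_ennreal2) (auto simp: suminf_mult)
  finally show "(\<integral>\<^sup>+y. ennreal (norm (x - y) powr (- s)) \<partial>ball_nu) \<le> ennreal M" .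
qed

text \<open>A form of Young's inequality without the usual constants: the curve \<open>v = u powr (1 / (p - 1))\<close>
  separates the region where the first term alone dominates the product from the one where the
  second does. It replaces Hoelder's inequality, as only boundedness of the potential is wanted
  and not its dependence on the norm of \<open>f\<close>.\<close>

lemma mult_le_powr_conjugate:
  fixes u v p :: real
  assumes "0 \<le> u" "0 \<le> v" "1 < p"
  shows "u * v \<le> u powr (p / (p - 1)) + v powr p"
proof (cases "v \<le> u powr (1 / (p - 1))")
  case True
  then have "u * v \<le> u powr 1 * u powr (1 / (p - 1))" using assms by (simp add: mult_left_mono)
  also have "\<dots> = u powr (p / (p - 1))"
    using assms by (subst powr_add[symmetric]) (auto simp: field_simps)
  finally show ?thesis by (simp add: add_increasing2)
next
  case False
  then have "(u powr (1 / (p - 1))) powr (p - 1) \<le> v powr (p - 1)"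
    using assms by (intro powr_mono2) auto
  then have "u \<le> v powr (p - 1)" using assms by (simp add: powr_powr)
  then have "u * v \<le> v powr (p - 1) * v powr 1" using assms by (simp add: mult_right_mono)
  also have "\<dots> = v powr p" by (subst powr_add[symmetric]) simp
  finally show ?thesis by (simp add: add_increasing)
qed

text \<open>The condition \<open>n < p\<close> says exactly that the conjugate exponent \<open>p / (p - 1)\<close> is below
  \<open>n / (n - 1)\<close>, so that this power of the kernel \<open>\<bar>x - y\<bar> powr (1 - n)\<close> is still integrable.\<close>

lemma riesz_potential_bounded:
  fixes f :: "'a::euclidean_space \<Rightarrow> 'b::euclidean_space"
  assumes n: "2 \<le> DIM('a)" and p: "real DIM('a) < p" and f: "in_Lp p ball_nu f"
  obtains M where "0 \<le> M"
    "\<And>x. x \<in> ball 0 1 \<Longrightarrow> integrable ball_nu (\<lambda>y. norm (f y) / norm (x - y) ^ (DIM('a) - 1))"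
    "\<And>x. x \<in> ball 0 1 \<Longrightarrow> (\<integral>y. norm (f y) / norm (x - y) ^ (DIM('a) - 1) \<partial>ball_nu) \<le> M"
proof -
  \<comment> \<open>The kernel raised to the conjugate exponent has a singularity of this order.\<close>
  define s where "s = (real DIM('a) - 1) * p / (p - 1)"
  have s: "0 \<le> s" "s < real DIM('a)" using n p by (auto simp: s_def field_simps)
  obtain M where M: "0 \<le> M" "\<And>x::'a. x \<in> ball 0 1 \<Longrightarrow>
       (\<integral>\<^sup>+y. ennreal (norm (x - y) powr (- s)) \<partial>ball_nu) \<le> ennreal M"
    using nn_integral_riesz_le[OF s] by metis
  define N where "N = (\<integral>y. norm (f y) powr p \<partial>ball_nu)"
  have N: "0 \<le> N" by (simp add: N_def)
  have [measurable]: "f \<in> borel_measurable (lebesgue_on (ball 0 1))"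
    and int: "integrable ball_nu (\<lambda>y. norm (f y) powr p)"
    using f by (auto simp: in_Lp_def)
  note [measurable] = id_measurable_lebesgue_on
  have main: "(\<integral>\<^sup>+y. ennreal (norm (f y) / norm (x - y) ^ (DIM('a) - 1)) \<partial>ball_nu) \<le> ennreal (M + N)"
    if x: "x \<in> ball 0 1" for x
  proof -
    have pt: "norm (f y) / norm (x - y) ^ (DIM('a) - 1) \<le> norm (x - y) powr (- s) + norm (f y) powr p" for y
    proof (cases "y = x")
      case False
      have "1 / norm (x - y) ^ (DIM('a) - 1) = norm (x - y) powr (1 - real DIM('a))"
        using False n by (simp add: powr_realpow[symmetric] of_nat_diff powr_minus[symmetric] inverse_eq_divide[symmetric])
      moreover have "(1 - real DIM('a)) * (p / (p - 1)) = - s"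
        by (simp add: s_def divide_inverse algebra_simps)
      ultimately have "(1 / norm (x - y) ^ (DIM('a) - 1)) powr (p / (p - 1)) = norm (x - y) powr (- s)"
        by (simp only: powr_powr)
      with mult_le_powr_conjugate[of "1 / norm (x - y) ^ (DIM('a) - 1)" "norm (f y)" p] n p
      show ?thesis by simp
    qed (use n in \<open>simp add: zero_power\<close>)
    have "(\<integral>\<^sup>+y. ennreal (norm (f y) / norm (x - y) ^ (DIM('a) - 1)) \<partial>ball_nu)
        \<le> (\<integral>\<^sup>+y. ennreal (norm (x - y) powr (- s)) + ennreal (norm (f y) powr p) \<partial>ball_nu)"
      using pt by (intro nn_integral_mono) (simp add: ennreal_plus[symmetric] ennreal_leI del: ennreal_plus)
    also have "\<dots> = (\<integral>\<^sup>+y. ennreal (norm (x - y) powr (- s)) \<partial>ball_nu) + ennreal N"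
      unfolding N_def by (subst nn_integral_add) (auto simp: nn_integral_eq_integral[OF int])
    also have "\<dots> \<le> ennreal (M + N)" using M x N by (simp add: add_right_mono)
    finally show ?thesis .
  qed
  show thesis
  proof
    show "0 \<le> M + N" using M N by simp
    fix x :: 'a assume x: "x \<in> ball 0 1"
    show i: "integrable ball_nu (\<lambda>y. norm (f y) / norm (x - y) ^ (DIM('a) - 1))"
      using main[OF x] by (intro integrableI_bounded) (auto intro: le_less_trans)
    show "(\<integral>y. norm (f y) / norm (x - y) ^ (DIM('a) - 1) \<partial>ball_nu) \<le> M + N"
      using main[OF x] M N by (subst (asm) nn_integral_eq_integral[OF i]) (auto simp del: ennreal_plus)
  qed
qed

section \<open>The bracket\<close>

lemma bracket_nonneg [simp]: "0 \<le> bracket x y"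
  and bracket_ge_one_minus: "1 - norm x * norm y \<le> bracket x y"
  and bracket_sq: "(bracket x y)\<^sup>2 = (norm (x - y))\<^sup>2 + (1 - (norm x)\<^sup>2) * (1 - (norm y)\<^sup>2)"
proof -
  have "x \<bullet> y \<le> norm x * norm y" by (rule norm_cauchy_schwarz)
  then have sq: "(1 - norm x * norm y)\<^sup>2 \<le> 1 + (norm x)\<^sup>2 * (norm y)\<^sup>2 - 2 * (x \<bullet> y)"
    by (simp add: power2_eq_square algebra_simps)
  then have nonneg: "0 \<le> 1 + (norm x)\<^sup>2 * (norm y)\<^sup>2 - 2 * (x \<bullet> y)"
    by (rule order_trans[rotated]) simp
  then show "0 \<le> bracket x y" by (simp add: bracket_def)
  show "1 - norm x * norm y \<le> bracket x y"
    unfolding bracket_def using sq by (rule real_le_rsqrt)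
  have "(norm (x - y))\<^sup>2 = (norm x)\<^sup>2 + (norm y)\<^sup>2 - 2 * (x \<bullet> y)"
    by (simp add: power2_norm_eq_inner inner_diff inner_commute algebra_simps)
  then show "(bracket x y)\<^sup>2 = (norm (x - y))\<^sup>2 + (1 - (norm x)\<^sup>2) * (1 - (norm y)\<^sup>2)"
    using nonneg by (simp add: bracket_def algebra_simps)
qed

lemma bracket_commute: "bracket x y = bracket y x"
  by (simp add: bracket_def inner_commute mult.commute)

lemma one_minus_norm_sq_pos: "x \<in> ball 0 1 \<Longrightarrow> 0 < 1 - (norm x)\<^sup>2"
  by (simp add: abs_square_less_1)

text \<open>The bracket dominates the boundary distance of either point. This is what turns a power of
  \<open>1 - \<bar>y\<bar>\<^sup>2\<close> in the weight into a power of \<open>1 - \<bar>x\<bar>\<^sup>2\<close>.\<close>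

lemma one_minus_norm_sq_le_bracket:
  assumes "x \<in> ball 0 1" "y \<in> ball 0 1"
  shows "1 - (norm x)\<^sup>2 \<le> 2 * bracket x y"
proof -
  have "norm x * norm y \<le> norm x * 1" using assms by (intro mult_left_mono) auto
  then have "1 - norm x \<le> bracket x y" using bracket_ge_one_minus[of x y] by simp
  moreover have "1 - (norm x)\<^sup>2 \<le> 2 * (1 - norm x)"
    using zero_le_power2[of "1 - norm x"] by (simp add: power2_eq_square algebra_simps)
  ultimately show ?thesis by simp
qed

lemma bracket_pos: "x \<in> ball 0 1 \<Longrightarrow> y \<in> ball 0 1 \<Longrightarrow> 0 < bracket x y"
  using one_minus_norm_sq_le_bracket[of x y] one_minus_norm_sq_pos[of x] by simp

lemma dist_less_bracket:
  assumes "x \<in> ball 0 1" "y \<in> ball 0 1"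
  shows "norm (x - y) < bracket x y"
proof (rule power_less_imp_less_base)
  show "(norm (x - y))\<^sup>2 < (bracket x y)\<^sup>2"
    using mult_pos_pos[OF assms[THEN one_minus_norm_sq_pos]] by (simp add: bracket_sq)
qed simp

text \<open>For \<open>y \<noteq> 0\<close> the bracket is a Euclidean distance, \<open>bracket x y = \<bar>\<bar>y\<bar> x - y / \<bar>y\<bar>\<bar>\<close>: up to the
  factor \<open>\<bar>y\<bar>\<close>, the distance from \<open>x\<close> to the reflection of \<open>y\<close> in the unit sphere.\<close>

lemma bracket_lipschitz:
  assumes "y \<in> ball 0 1"
  shows "\<bar>bracket x y - bracket x' y\<bar> \<le> norm (x - x')"
proof (cases "y = 0")
  case False
  have eq: "bracket z y = norm (norm y *\<^sub>R z - sgn y)" for z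
  proof -
    have "norm y * (z \<bullet> sgn y) = z \<bullet> y" using False by (simp add: sgn_div_norm)
    then have "(norm (norm y *\<^sub>R z - sgn y))\<^sup>2 = 1 + (norm z)\<^sup>2 * (norm y)\<^sup>2 - 2 * (z \<bullet> y)"
      using False dot_norm_neg[of "norm y *\<^sub>R z" "sgn y"]
      by (simp add: norm_sgn power_mult_distrib mult.commute)
    then show ?thesis unfolding bracket_def by (metis norm_ge_zero real_sqrt_unique)
  qed
  have "\<bar>bracket x y - bracket x' y\<bar> \<le> norm ((norm y *\<^sub>R x - sgn y) - (norm y *\<^sub>R x' - sgn y))"
    unfolding eq by (rule norm_triangle_ineq3)
  also have "\<dots> = norm y * norm (x - x')"
    by (simp flip: scaleR_diff_right)
  also have "\<dots> \<le> 1 * norm (x - x')" using assms by (intro mult_right_mono) auto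
  finally show ?thesis by simp
qed (simp add: bracket_def)

section \<open>The radial profile of the Green function\<close>

lemma green_profile_integrable:
  assumes "0 < (r::real)"
  shows "(\<lambda>t::real. (1 - t\<^sup>2) ^ (n - 2) / t ^ (n - 1)) integrable_on {r..s}"
  using assms by (intro integrable_continuous_interval continuous_intros) auto

lemma green_profile_nonneg: "0 < r \<Longrightarrow> 0 \<le> green_profile n r"
  unfolding green_profile_def
  by (intro integral_nonneg green_profile_integrable) (auto simp: abs_square_le_1)

text \<open>The integrand decreases on the unit interval, so its left end value bounds it.\<close>

lemma green_profile_diff_bounds:
  assumes "0 < s" "s \<le> t" "t \<le> 1"
  shows "0 \<le> green_profile n s - green_profile n t"
    and "green_profile n s - green_profile n t \<le> (t - s) * ((1 - s\<^sup>2) ^ (n - 2) / s ^ (n - 1))"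
proof -
  let ?h = "\<lambda>t::real. (1 - t\<^sup>2) ^ (n - 2) / t ^ (n - 1)"
  have "integral {s..t} ?h + integral {t..1} ?h = integral {s..1} ?h"
    using assms by (intro Henstock_Kurzweil_Integration.integral_combine green_profile_integrable) auto
  then have eq: "green_profile n s - green_profile n t = integral {s..t} ?h"
    by (simp add: green_profile_def)
  show "0 \<le> green_profile n s - green_profile n t"
    unfolding eq using assms
    by (intro integral_nonneg green_profile_integrable) (auto simp: abs_square_le_1)
  have "integral {s..t} ?h \<le> integral {s..t} (\<lambda>_. ?h s)"
  proof (rule integral_le)
    fix u assume "u \<in> {s..t}"
    then show "?h u \<le> ?h s"
      using assms by (intro frac_le power_mono) (auto simp: abs_square_le_1 intro!: power_mono)
  qed (use assms in \<open>auto intro!: green_profile_integrable simp del: One_nat_def\<close>)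
  then show "green_profile n s - green_profile n t \<le> (t - s) * ?h s"
    unfolding eq using assms by simp
qed

text \<open>One factor \<open>1 - r \<le> 1 - r\<^sup>2\<close> comes from the length of the interval. The order \<open>1 - n\<close> of the
  singularity at \<open>0\<close> is worse by one than the true order (a logarithm if \<open>n = 2\<close>), but it is the
  order of the gradient, it needs no case distinction on \<open>n\<close>, and it is still integrable to the conjugate power.\<close>

lemma green_profile_le:
  assumes "0 < r" "r \<le> 1" "2 \<le> n"
  shows "green_profile n r \<le> ((1 - r\<^sup>2) / r) ^ (n - 1)"
proof -
  obtain k where k: "n = Suc (Suc k)" using assms(3) by (metis add_2_eq_Suc le_iff_add)
  have r2: "r\<^sup>2 \<le> 1" using assms by (simp add: abs_square_le_1)
  have "green_profile n 1 = 0" by (simp add: green_profile_def)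
  then have "green_profile n r \<le> (1 - r) * ((1 - r\<^sup>2) ^ (n - 2) / r ^ (n - 1))"
    using green_profile_diff_bounds(2)[of r 1 n] assms by simp
  also have "\<dots> \<le> (1 - r\<^sup>2) * ((1 - r\<^sup>2) ^ (n - 2) / r ^ (n - 1))"
    using assms r2 by (intro mult_right_mono) (auto simp: power2_eq_square mult_left_le)
  also have "\<dots> = ((1 - r\<^sup>2) / r) ^ (n - 1)" by (simp add: k power_divide)
  finally show ?thesis .
qed

lemma continuous_on_green_profile: "continuous_on {0<..<1} (green_profile n)"
proof (subst continuous_on_eq_continuous_at)
  show "\<forall>r\<in>{0<..<1}. isCont (green_profile n) r"
  proof
    fix r :: real assume r: "r \<in> {0<..<1}"
    have "continuous_on {r/2..1} (green_profile n)"
      unfolding green_profile_def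
      using r by (intro indefinite_integral_continuous_1' green_profile_integrable) auto
    then have "continuous_on {r/2<..<1} (green_profile n)"
      by (rule continuous_on_subset) auto
    then show "isCont (green_profile n) r"
      using r by (subst (asm) continuous_on_eq_continuous_at) auto
  qed
qed simp

lemma hyp_green_measurable:
  assumes "x \<in> ball 0 1"
  shows "hyp_green x \<in> borel_measurable (lebesgue_on (ball 0 1))"
proof -
  have "continuous_on (ball 0 1 - {x}) (hyp_green x)"
    unfolding hyp_green_def
  proof (rule continuous_on_compose2[OF continuous_on_green_profile])
    show "continuous_on (ball 0 1 - {x}) (\<lambda>y. norm (x - y) / bracket x y)"
      using assms bracket_pos[OF assms] unfolding bracket_def
      by (intro continuous_intros) (force simp: bracket_def)
    show "(\<lambda>y. norm (x - y) / bracket x y) ` (ball 0 1 - {x}) \<subseteq> {0<..<1}"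
    proof (rule image_subsetI)
      fix y assume "y \<in> ball 0 1 - {x}"
      then show "norm (x - y) / bracket x y \<in> {0<..<1}"
        using dist_less_bracket[OF assms, of y] bracket_pos[OF assms, of y] by auto
    qed
  qed
  then have "hyp_green x \<in> borel_measurable (lebesgue_on (ball 0 1 - {x}))"
    by (rule continuous_imp_measurable_on_sets_lebesgue) auto
  then have "(\<lambda>y. if y \<in> ball 0 1 - {x} then hyp_green x y else 0) \<in> borel_measurable (lebesgue_on (ball 0 1))"
    by (subst borel_measurable_if_lebesgue_on) auto
  then show ?thesis
  proof (rule measurable_discrete_difference)
    show "countable {x}" by simp
    show "{z} \<in> sets (lebesgue_on (ball 0 1))" if "z \<in> {x}" for z
    proof -
      have "z \<in> ball 0 1" using that assms by simp
      then show ?thesis by (simp add: sets_restrict_space_iff)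
    qed
    show "hyp_green x z \<in> space borel" for z by simp
    show "(if y \<in> ball 0 1 - {x} then hyp_green x y else 0) = hyp_green x y"
      if "y \<in> space (lebesgue_on (ball 0 1))" "y \<notin> {x}" for y
      using that by simp
  qed
qed

section \<open>Size and variation of the Green function\<close>

lemma one_minus_pseudo_dist_sq:
  assumes "x \<in> ball 0 1" "y \<in> ball 0 1"
  shows "1 - (norm (x - y) / bracket x y)\<^sup>2
    = (1 - (norm x)\<^sup>2) * (1 - (norm y)\<^sup>2) / (bracket x y)\<^sup>2"
  using bracket_pos[OF assms] bracket_sq[of x y] by (simp add: field_simps)

lemma hyp_green_bounds:
  fixes x y :: "'a::euclidean_space"
  assumes n: "2 \<le> DIM('a)" and xy: "x \<in> ball 0 1" "y \<in> ball 0 1" "y \<noteq> x"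
  shows "0 \<le> hyp_green x y"
    and "hyp_green x y \<le> ((1 - (norm x)\<^sup>2) * (1 - (norm y)\<^sup>2) / (bracket x y * norm (x - y))) ^ (DIM('a) - 1)"
proof -
  define r where "r = norm (x - y) / bracket x y"
  have A: "0 < bracket x y" using bracket_pos xy by blast
  have r: "0 < r" "r < 1" using A dist_less_bracket[OF xy(1,2)] xy(3) by (auto simp: r_def)
  show "0 \<le> hyp_green x y" using green_profile_nonneg[OF r(1)] by (simp add: hyp_green_def r_def)
  have "(1 - r\<^sup>2) / r = (1 - (norm x)\<^sup>2) * (1 - (norm y)\<^sup>2) / (bracket x y * norm (x - y))"
    using A xy(3) unfolding r_def one_minus_pseudo_dist_sq[OF xy(1,2)]
    by (simp add: power2_eq_square)
  with green_profile_le[of r "DIM('a)"] r n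
  show "hyp_green x y \<le> ((1 - (norm x)\<^sup>2) * (1 - (norm y)\<^sup>2) / (bracket x y * norm (x - y))) ^ (DIM('a) - 1)"
    by (simp add: hyp_green_def r_def)
qed

text \<open>A discrete form of the gradient bound \<open>(1 - \<bar>y\<bar>\<^sup>2) / (bracket x y)\<^sup>2\<close> for the pseudo-hyperbolic
  distance. Working with differences avoids integrating the gradient along a segment, which
  might pass through the singularity \<open>y\<close>. The squared distance is rational in the data, so the
  difference of the squares is computed first and then divided by the sum.\<close>

lemma pseudo_dist_diff_le:
  fixes x x' y :: "'a::euclidean_space"
  assumes x: "x \<in> ball 0 1" and x': "x' \<in> ball 0 1" and y: "y \<in> ball 0 1"
    and ne: "y \<noteq> x" and A': "bracket x' y \<le> 2 * bracket x y" "bracket x y \<le> 2 * bracket x' y"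
  shows "\<bar>norm (x - y) / bracket x y - norm (x' - y) / bracket x' y\<bar>
    \<le> 16 * norm (x - x') * (1 - (norm y)\<^sup>2) / (bracket x y)\<^sup>2"
proof -
  define A A' a a' s s' d where defs: "A = bracket x y" "A' = bracket x' y" "a = norm (x - y)"
    "a' = norm (x' - y)" "s = a / A" "s' = a' / A'" "d = 1 - (norm y)\<^sup>2"
  define e e' \<delta> where defs': "e = 1 - (norm x)\<^sup>2" "e' = 1 - (norm x')\<^sup>2" "\<delta> = norm (x - x')"
  have pos: "0 < A" "0 < A'" "0 < a" "0 \<le> a'" "0 < d" "0 < e" "0 < e'" "0 \<le> \<delta>"
    using assms bracket_pos one_minus_norm_sq_pos unfolding defs defs' by auto
  have cmp: "A' \<le> 2 * A" "A \<le> 2 * A'" using A' by (auto simp: defs)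
  have sq: "1 - s\<^sup>2 = e * d / A\<^sup>2" "1 - s'\<^sup>2 = e' * d / A'\<^sup>2"
    using one_minus_pseudo_dist_sq assms by (auto simp: defs defs')
  have A2: "A\<^sup>2 = a\<^sup>2 + e * d" "A'\<^sup>2 = a'\<^sup>2 + e' * d" by (auto simp: defs defs' bracket_sq)
  have aa: "\<bar>a - a'\<bar> \<le> \<delta>"
    using norm_triangle_ineq3[of "x - y" "x' - y"] by (simp add: defs defs')
  have ee: "\<bar>e' - e\<bar> \<le> 2 * \<delta>"
  proof -
    have "e' - e = (norm x - norm x') * (norm x + norm x')"
      by (simp add: defs' power2_eq_square algebra_simps)
    then have "\<bar>e' - e\<bar> = \<bar>norm x - norm x'\<bar> * (norm x + norm x')" by (simp add: abs_mult)
    also have "\<dots> \<le> \<delta> * 2"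
      using x x' unfolding defs' by (intro mult_mono norm_triangle_ineq3) auto
    finally show ?thesis by simp
  qed
  have eA: "e' \<le> 2 * A'" using one_minus_norm_sq_le_bracket[OF x' y] by (simp add: defs defs')
  have aA: "a' \<le> A'" using dist_less_bracket[OF x' y] by (simp add: defs)
  \<comment> \<open>The terms \<open>e * e' * d\<close> cancel, which leaves only increments of \<open>a\<^sup>2\<close> and \<open>e\<close>.\<close>
  have num: "s\<^sup>2 - s'\<^sup>2 = d * (e' * (a\<^sup>2 - a'\<^sup>2) + (e' - e) * a'\<^sup>2) / (A\<^sup>2 * A'\<^sup>2)"
  proof -
    have "s\<^sup>2 - s'\<^sup>2 = e' * d / A'\<^sup>2 - e * d / A\<^sup>2" using sq by simp
    also have "\<dots> = (e' * d * A\<^sup>2 - e * d * A'\<^sup>2) / (A\<^sup>2 * A'\<^sup>2)"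
      using pos by (simp add: field_simps)
    also have "e' * d * A\<^sup>2 - e * d * A'\<^sup>2 = d * (e' * (a\<^sup>2 - a'\<^sup>2) + (e' - e) * a'\<^sup>2)"
      unfolding A2 by (simp add: algebra_simps)
    finally show ?thesis .
  qed
  have "\<bar>e' * (a\<^sup>2 - a'\<^sup>2) + (e' - e) * a'\<^sup>2\<bar> \<le> \<bar>e' * (a\<^sup>2 - a'\<^sup>2)\<bar> + \<bar>(e' - e) * a'\<^sup>2\<bar>"
    by (rule abs_triangle_ineq)
  also have "\<dots> = e' * (\<bar>a - a'\<bar> * (a + a')) + \<bar>e' - e\<bar> * (a' * a')"
    using pos by (simp add: abs_mult power2_eq_square square_diff_square_factored)
  also have "\<dots> \<le> (2 * A') * (\<delta> * (a + a')) + (2 * \<delta>) * (A' * (a + a'))"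
    using pos aa ee eA aA by (intro add_mono mult_mono) auto
  finally have N: "\<bar>e' * (a\<^sup>2 - a'\<^sup>2) + (e' - e) * a'\<^sup>2\<bar> \<le> 4 * A' * \<delta> * (a + a')"
    by (simp add: algebra_simps)
  have ss: "(a + a') / (2 * A) \<le> s + s'"
  proof -
    have "a / (2 * A) \<le> a / A" "a' / (2 * A) \<le> a' / A'"
      using pos cmp by (intro frac_le; simp)+
    then show ?thesis by (simp add: defs add_divide_distrib)
  qed
  have s0: "0 \<le> s" "0 \<le> s'" using pos by (auto simp: defs)
  have "\<bar>s - s'\<bar> * ((a + a') / (2 * A)) \<le> \<bar>s - s'\<bar> * (s + s')"
    using ss by (intro mult_left_mono) auto
  also have "\<dots> = \<bar>s\<^sup>2 - s'\<^sup>2\<bar>"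
    using s0 by (simp add: abs_mult power2_eq_square square_diff_square_factored)
  also have "\<dots> \<le> d * (4 * A' * \<delta> * (a + a')) / (A\<^sup>2 * A'\<^sup>2)"
    unfolding num using pos N by (simp add: abs_mult divide_right_mono)
  finally have "\<bar>s - s'\<bar> * ((a + a') / (2 * A)) \<le> d * (4 * A' * \<delta> * (a + a')) / (A\<^sup>2 * A'\<^sup>2)" .
  moreover have "d * (4 * A' * \<delta> * (a + a')) / (A\<^sup>2 * A'\<^sup>2)
      = (8 * d * \<delta> / (A * A')) * ((a + a') / (2 * A))"
    using pos by (simp add: power2_eq_square field_simps)
  ultimately have "\<bar>s - s'\<bar> \<le> 8 * d * \<delta> / (A * A')"
    using pos by (simp only: mult_le_cancel_right) (smt (verit) divide_pos_pos)
  also have "\<dots> \<le> 8 * d * \<delta> / (A * (A / 2))"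
    using pos cmp by (intro divide_left_mono mult_left_mono) auto
  also have "\<dots> = 16 * \<delta> * d / A\<^sup>2" by (simp add: power2_eq_square)
  finally show ?thesis by (simp add: defs defs')
qed

text \<open>If \<open>x\<close> and \<open>x'\<close> are closer to each other than to the sphere, their brackets with \<open>y\<close> are
  comparable, hence so are all quantities except the distances to \<open>y\<close>; the variation of the
  profile is then its derivative times the variation of the pseudo-hyperbolic distance. Since
  either point may be the one near \<open>y\<close>, both singularities appear on the right.\<close>

lemma hyp_green_diff_le:
  fixes x x' y :: "'a::euclidean_space"
  assumes n: "DIM('a) = k + 2"
    and x: "x \<in> ball 0 1" and x': "x' \<in> ball 0 1" and y: "y \<in> ball 0 1"
    and ne: "y \<noteq> x" "y \<noteq> x'"
    and le: "norm x \<le> norm x'" and near: "4 * norm (x - x') \<le> 1 - (norm x)\<^sup>2"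
  shows "\<bar>hyp_green x y - hyp_green x' y\<bar>
    \<le> 32 * 8 ^ k * norm (x - x') * (1 - (norm x)\<^sup>2) ^ k * (1 - (norm y)\<^sup>2) ^ Suc k / bracket x y ^ Suc k
        * (1 / norm (x - y) ^ Suc k + 1 / norm (x' - y) ^ Suc k)"
proof -
  define A A' a a' s s' d where defs: "A = bracket x y" "A' = bracket x' y" "a = norm (x - y)"
    "a' = norm (x' - y)" "s = a / A" "s' = a' / A'" "d = 1 - (norm y)\<^sup>2"
  define e e' \<delta> where defs': "e = 1 - (norm x)\<^sup>2" "e' = 1 - (norm x')\<^sup>2" "\<delta> = norm (x - x')"
  have pos: "0 < A" "0 < A'" "0 < a" "0 < a'" "0 < d" "0 < e" "0 < e'" "0 \<le> \<delta>"
    using x x' y ne bracket_pos one_minus_norm_sq_pos unfolding defs defs' by auto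
  have e'e: "e' \<le> e" using le by (simp add: defs' power_mono)
  have "\<bar>A - A'\<bar> \<le> \<delta>" using bracket_lipschitz[OF y] by (simp add: defs defs')
  moreover have "4 * \<delta> \<le> 2 * A"
    using near one_minus_norm_sq_le_bracket[OF x y] by (simp add: defs defs')
  ultimately have cmp: "A' \<le> 2 * A" "A \<le> 2 * A'" by auto
  have ss: "\<bar>s - s'\<bar> \<le> 16 * \<delta> * d / A\<^sup>2"
    using pseudo_dist_diff_le[OF x x' y ne(1)] cmp by (simp add: defs defs')
  have s01: "0 < s" "s \<le> 1" "0 < s'" "s' \<le> 1"
    using pos dist_less_bracket[OF x y] dist_less_bracket[OF x' y] by (auto simp: defs)
  \<comment> \<open>The profile is estimated at the smaller of \<open>s\<close> and \<open>s'\<close>. As the order of the two is unknown, every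
     factor is bounded by a quantity that serves both.\<close>
  define \<Sigma> where "\<Sigma> = 1 / a ^ Suc k + 1 / a' ^ Suc k"
  have \<Sigma>: "1 / a ^ Suc k \<le> \<Sigma>" "1 / a' ^ Suc k \<le> \<Sigma>" using pos by (auto simp: \<Sigma>_def)
  have sq: "1 - s\<^sup>2 \<le> 4 * e * d / A\<^sup>2" "1 - s'\<^sup>2 \<le> 4 * e * d / A\<^sup>2"
  proof -
    have "1 - s\<^sup>2 = e * d / A\<^sup>2" using one_minus_pseudo_dist_sq x y by (auto simp: defs defs')
    also have "\<dots> \<le> 4 * e * d / A\<^sup>2" using pos by (intro divide_right_mono) auto
    finally show "1 - s\<^sup>2 \<le> 4 * e * d / A\<^sup>2" .
    have "1 - s'\<^sup>2 = e' * d / A'\<^sup>2" using one_minus_pseudo_dist_sq x' y by (auto simp: defs defs')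
    also have "\<dots> \<le> e * d / (A / 2)\<^sup>2"
      using pos cmp e'e by (intro frac_le mult_right_mono power_mono) auto
    also have "\<dots> = 4 * e * d / A\<^sup>2" by (simp add: power_divide)
    finally show "1 - s'\<^sup>2 \<le> 4 * e * d / A\<^sup>2" .
  qed
  have inv: "1 / s ^ Suc k \<le> (2 * A) ^ Suc k * \<Sigma>" "1 / s' ^ Suc k \<le> (2 * A) ^ Suc k * \<Sigma>"
  proof -
    have "1 / s ^ Suc k = A ^ Suc k * (1 / a ^ Suc k)" by (simp add: defs power_divide)
    also have "\<dots> \<le> (2 * A) ^ Suc k * \<Sigma>"
      using pos \<Sigma> by (intro mult_mono power_mono) auto
    finally show "1 / s ^ Suc k \<le> (2 * A) ^ Suc k * \<Sigma>" .
    have "1 / s' ^ Suc k = A' ^ Suc k * (1 / a' ^ Suc k)" by (simp add: defs power_divide)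
    also have "\<dots> \<le> (2 * A) ^ Suc k * \<Sigma>"
      using pos \<Sigma> cmp by (intro mult_mono power_mono) auto
    finally show "1 / s' ^ Suc k \<le> (2 * A) ^ Suc k * \<Sigma>" .
  qed
  define R where "R = (16 * \<delta> * d / A\<^sup>2) * ((4 * e * d / A\<^sup>2) ^ k * ((2 * A) ^ Suc k * \<Sigma>))"
  have bound: "\<bar>green_profile (k + 2) u - green_profile (k + 2) v\<bar> \<le> R"
    if "0 < u" "u \<le> v" "v \<le> 1" "v - u \<le> 16 * \<delta> * d / A\<^sup>2" "1 - u\<^sup>2 \<le> 4 * e * d / A\<^sup>2"
       "1 / u ^ Suc k \<le> (2 * A) ^ Suc k * \<Sigma>" for u v
  proof -
    have "\<bar>green_profile (k + 2) u - green_profile (k + 2) v\<bar> \<le> (v - u) * ((1 - u\<^sup>2) ^ k * (1 / u ^ Suc k))"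
      using green_profile_diff_bounds[OF that(1-3), of "k + 2"] by simp
    also have "\<dots> \<le> R"
      unfolding R_def using that pos
      by (intro mult_mono power_mono) (auto simp: abs_square_le_1 intro!: divide_nonneg_nonneg)
    finally show ?thesis .
  qed
  have "\<bar>hyp_green x y - hyp_green x' y\<bar> = \<bar>green_profile (k + 2) s - green_profile (k + 2) s'\<bar>"
    using n by (simp add: hyp_green_def defs)
  also have "\<dots> \<le> R"
  proof (cases "s \<le> s'")
    case True
    then show ?thesis using bound[of s s'] s01 sq inv ss by auto
  next
    case False
    then show ?thesis using bound[of s' s] s01 sq inv ss by (auto simp: abs_minus_commute)
  qed
  also have "R = 32 * 8 ^ k * \<delta> * e ^ k * d ^ Suc k / A ^ Suc k * \<Sigma>"
  proof -
    have "(8::real) ^ k = 4 ^ k * 2 ^ k" by (simp flip: power_mult_distrib)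
    then show ?thesis
      using pos by (simp add: R_def power_divide power_mult_distrib power2_eq_square field_simps)
  qed
  finally show ?thesis by (simp only: defs defs' \<Sigma>_def)
qed

section \<open>The weighted kernel\<close>

text \<open>Of the factors \<open>(1 - \<bar>x\<bar>\<^sup>2) / bracket x y \<le> 2\<close>, all but one are simply bounded by \<open>2\<close>; the last
  one, divided by \<open>2\<close>, lies in the unit interval and may be raised to the power \<open>\<alpha> \<le> 1\<close>, where it
  absorbs \<open>(1 - \<bar>y\<bar>\<^sup>2) powr \<alpha> \<le> (2 * bracket x y) powr \<alpha>\<close>.\<close>

lemma weight_balance:
  fixes x y :: "'a::euclidean_space"
  assumes x: "x \<in> ball 0 1" and y: "y \<in> ball 0 1" and \<alpha>: "0 < \<alpha>" "\<alpha> \<le> 1"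
  shows "((1 - (norm x)\<^sup>2) / bracket x y) ^ Suc k * (1 - (norm y)\<^sup>2) powr \<alpha>
    \<le> 2 ^ Suc k * (1 - (norm x)\<^sup>2) powr \<alpha>"
proof -
  define A d e where defs: "A = bracket x y" "d = 1 - (norm y)\<^sup>2" "e = 1 - (norm x)\<^sup>2"
  have pos: "0 < A" "0 < d" "0 < e"
    using x y bracket_pos one_minus_norm_sq_pos unfolding defs by auto
  have eA: "e \<le> 2 * A" using one_minus_norm_sq_le_bracket[OF x y] by (simp add: defs)
  have dA: "d \<le> 2 * A"
    using one_minus_norm_sq_le_bracket[OF y x] by (simp add: defs bracket_commute)
  define q where "q = e / (2 * A)"
  have q: "0 < q" "q \<le> 1" using pos eA by (auto simp: q_def)
  have "(e / A) ^ Suc k * d powr \<alpha> = 2 ^ Suc k * (q ^ Suc k * d powr \<alpha>)"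
    by (simp add: q_def power_divide power_mult_distrib)
  also have "\<dots> \<le> 2 ^ Suc k * (q powr \<alpha> * (2 * A) powr \<alpha>)"
  proof (intro mult_left_mono mult_mono)
    have "q ^ Suc k \<le> q powr 1" using q power_le_one[of q k] by (simp add: mult_left_le)
    also have "\<dots> \<le> q powr \<alpha>" using q \<alpha> by (intro powr_mono') auto
    finally show "q ^ Suc k \<le> q powr \<alpha>" .
    show "d powr \<alpha> \<le> (2 * A) powr \<alpha>" using pos dA \<alpha> by (intro powr_mono2) auto
  qed auto
  also have "q powr \<alpha> * (2 * A) powr \<alpha> = e powr \<alpha>"
    using pos by (simp add: q_def flip: powr_mult)
  finally show ?thesis by (simp only: defs)
qed

text \<open>The kernel that represents the Green integral of \<open>\<psi>\<close> with respect to \<open>\<nu>\<close> in terms of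
  \<open>(1 - \<bar>y\<bar>\<^sup>2) powr (-1 - \<alpha>) \<psi>\<close>, the function assumed to lie in \<open>L\<^sup>p\<close>.\<close>

definition hyp_kernel :: "real \<Rightarrow> 'a::euclidean_space \<Rightarrow> 'a \<Rightarrow> real" where
  "hyp_kernel \<alpha> x y = hyp_green x y * ((1 - (norm y)\<^sup>2) powr (1 + \<alpha>) / (1 - (norm y)\<^sup>2) ^ DIM('a))"

lemma hyp_kernel_le:
  fixes x y :: "'a::euclidean_space"
  assumes n: "DIM('a) = k + 2" and x: "x \<in> ball 0 1" and y: "y \<in> ball 0 1" and ne: "y \<noteq> x"
    and \<alpha>: "0 < \<alpha>" "\<alpha> \<le> 1"
  shows "\<bar>hyp_kernel \<alpha> x y\<bar> \<le> 2 ^ Suc k * (1 - (norm x)\<^sup>2) powr \<alpha> / norm (x - y) ^ Suc k"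
proof -
  define A a d e where defs: "A = bracket x y" "a = norm (x - y)" "d = 1 - (norm y)\<^sup>2" "e = 1 - (norm x)\<^sup>2"
  have pos: "0 < A" "0 < a" "0 < d" "0 < e"
    using x y ne bracket_pos one_minus_norm_sq_pos unfolding defs by auto
  have w: "d powr (1 + \<alpha>) / d ^ (k + 2) = d powr \<alpha> / d ^ Suc k"
    using pos by (simp add: powr_add)
  have "\<bar>hyp_kernel \<alpha> x y\<bar> = hyp_green x y * (d powr \<alpha> / d ^ Suc k)"
    using hyp_green_bounds(1)[of x y] n x y ne pos w by (simp add: hyp_kernel_def defs abs_mult)
  also have "\<dots> \<le> (e * d / (A * a)) ^ Suc k * (d powr \<alpha> / d ^ Suc k)"
    using hyp_green_bounds(2)[of x y] n x y ne pos by (intro mult_right_mono) (auto simp: defs)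
  also have "\<dots> = ((e / A) ^ Suc k * d powr \<alpha>) / a ^ Suc k"
    using pos by (simp add: power_divide power_mult_distrib field_simps)
  also have "\<dots> \<le> (2 ^ Suc k * e powr \<alpha>) / a ^ Suc k"
    using weight_balance[OF x y \<alpha>, of k] pos by (intro divide_right_mono) (auto simp: defs)
  finally show ?thesis by (simp only: defs)
qed

text \<open>The two regimes of the Hoelder estimate. With \<open>\<delta> = \<bar>x - x'\<bar>\<close> and \<open>e = 1 - \<bar>x\<bar>\<^sup>2\<close>, where \<open>x\<close> is the
  point farther from the sphere: if \<open>4 * \<delta> \<le> e\<close>, the difference bound carries the factor
  \<open>(\<delta> / e) * e powr \<alpha>\<close>, and \<open>\<delta> / e \<le> (\<delta> / e) powr \<alpha>\<close> makes that at most \<open>\<delta> powr \<alpha>\<close>. Otherwise both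
  points lie within a multiple of \<open>\<delta>\<close> of the sphere, and the two kernels separately carry no more
  than a multiple of \<open>\<delta> powr \<alpha>\<close>.\<close>

lemma hyp_kernel_holder:
  fixes x x' y :: "'a::euclidean_space"
  assumes n: "DIM('a) = k + 2" and x: "x \<in> ball 0 1" and x': "x' \<in> ball 0 1" and y: "y \<in> ball 0 1"
    and ne: "y \<noteq> x" "y \<noteq> x'" and \<alpha>: "0 < \<alpha>" "\<alpha> \<le> 1"
  shows "\<bar>hyp_kernel \<alpha> x y - hyp_kernel \<alpha> x' y\<bar>
    \<le> 64 * 16 ^ k * norm (x - x') powr \<alpha> * (1 / norm (x - y) ^ Suc k + 1 / norm (x' - y) ^ Suc k)"
  using x x' ne
proof (induction "norm x" "norm x'" arbitrary: x x' rule: linorder_wlog)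
  case (sym x' x)
  from sym(1)[of x x'] sym(2-) show ?case
    by (simp add: abs_minus_commute norm_minus_commute add.commute)
next
  case (le x x')
  define A a a' d where defs: "A = bracket x y" "a = norm (x - y)" "a' = norm (x' - y)" "d = 1 - (norm y)\<^sup>2"
  define e e' \<delta> where defs': "e = 1 - (norm x)\<^sup>2" "e' = 1 - (norm x')\<^sup>2" "\<delta> = norm (x - x')"
  define \<Sigma> where "\<Sigma> = 1 / a ^ Suc k + 1 / a' ^ Suc k"
  have pos: "0 < A" "0 < a" "0 < a'" "0 < d" "0 < e" "0 < e'" "0 \<le> \<delta>" "0 < \<Sigma>"
    using le(2-) y bracket_pos one_minus_norm_sq_pos unfolding defs defs' \<Sigma>_def by (auto intro!: add_pos_pos)
  have "\<bar>hyp_kernel \<alpha> x y - hyp_kernel \<alpha> x' y\<bar> \<le> 64 * 16 ^ k * \<delta> powr \<alpha> * \<Sigma>"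
  proof (cases "4 * \<delta> \<le> e")
    case True
    have w: "d powr (1 + \<alpha>) / d ^ (k + 2) = d powr \<alpha> / d ^ Suc k"
      using pos by (simp add: powr_add)
    have "hyp_kernel \<alpha> x y - hyp_kernel \<alpha> x' y = (hyp_green x y - hyp_green x' y) * (d powr \<alpha> / d ^ Suc k)"
      by (simp only: hyp_kernel_def n w left_diff_distrib flip: defs(4))
    then have "\<bar>hyp_kernel \<alpha> x y - hyp_kernel \<alpha> x' y\<bar> = \<bar>hyp_green x y - hyp_green x' y\<bar> * (d powr \<alpha> / d ^ Suc k)"
      using pos by (simp add: abs_mult)
    also have "\<dots> \<le> (32 * 8 ^ k * \<delta> * e ^ k * d ^ Suc k / A ^ Suc k * \<Sigma>) * (d powr \<alpha> / d ^ Suc k)"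
      using hyp_green_diff_le[OF n, of x x' y] le y True pos
      by (intro mult_right_mono) (auto simp: defs defs' \<Sigma>_def)
    also have "\<dots> = 32 * 8 ^ k * (\<delta> / e) * ((e / A) ^ Suc k * d powr \<alpha>) * \<Sigma>"
      using pos by (simp add: power_divide)
    also have "\<dots> \<le> 32 * 8 ^ k * (\<delta> / e) powr \<alpha> * (2 ^ Suc k * e powr \<alpha>) * \<Sigma>"
    proof -
      have "(\<delta> / e) powr 1 \<le> (\<delta> / e) powr \<alpha>"
        using pos True \<alpha> by (intro powr_mono') auto
      then have ratio: "\<delta> / e \<le> (\<delta> / e) powr \<alpha>" using pos by simp
      have balance: "(e / A) ^ Suc k * d powr \<alpha> \<le> 2 ^ Suc k * e powr \<alpha>"
        using weight_balance[OF _ y \<alpha>, of x k] le by (simp add: defs defs')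
      show ?thesis
        by (rule mult_right_mono[OF mult_mono[OF mult_left_mono[OF ratio] balance]])
          (use pos in auto)
    qed
    also have "\<dots> = 64 * 16 ^ k * ((\<delta> / e) powr \<alpha> * e powr \<alpha>) * \<Sigma>"
    proof -
      have "(16::real) ^ k = 8 ^ k * 2 ^ k" by (simp flip: power_mult_distrib)
      then show ?thesis by simp
    qed
    also have "(\<delta> / e) powr \<alpha> * e powr \<alpha> = \<delta> powr \<alpha>"
      using pos by (simp flip: powr_mult)
    finally show ?thesis .
  next
    case False
    have "e' \<le> e" using le by (simp add: defs' power_mono)
    then have e: "e powr \<alpha> \<le> 4 * \<delta> powr \<alpha>" "e' powr \<alpha> \<le> 4 * \<delta> powr \<alpha>"
    proof -
      have "z powr \<alpha> \<le> 4 * \<delta> powr \<alpha>" if "0 < z" "z \<le> 4 * \<delta>" for z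
      proof -
        have "z powr \<alpha> \<le> (4 * \<delta>) powr \<alpha>" using that \<alpha> by (intro powr_mono2) auto
        also have "\<dots> = 4 powr \<alpha> * \<delta> powr \<alpha>" using pos by (simp add: powr_mult)
        also have "\<dots> \<le> 4 powr 1 * \<delta> powr \<alpha>" using \<alpha> by (intro mult_right_mono powr_mono) auto
        finally show ?thesis by simp
      qed
      then show "e powr \<alpha> \<le> 4 * \<delta> powr \<alpha>" "e' powr \<alpha> \<le> 4 * \<delta> powr \<alpha>"
        using False pos \<open>e' \<le> e\<close> by auto
    qed
    have "\<bar>hyp_kernel \<alpha> x y - hyp_kernel \<alpha> x' y\<bar> \<le> \<bar>hyp_kernel \<alpha> x y\<bar> + \<bar>hyp_kernel \<alpha> x' y\<bar>"
      by (rule abs_triangle_ineq4)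
    also have "\<dots> \<le> 2 ^ Suc k * e powr \<alpha> / a ^ Suc k + 2 ^ Suc k * e' powr \<alpha> / a' ^ Suc k"
      using hyp_kernel_le[OF n _ y _ \<alpha>] le by (intro add_mono) (auto simp: defs defs')
    also have "\<dots> \<le> 2 ^ Suc k * (4 * \<delta> powr \<alpha>) / a ^ Suc k + 2 ^ Suc k * (4 * \<delta> powr \<alpha>) / a' ^ Suc k"
      using pos e by (intro add_mono divide_right_mono mult_left_mono) auto
    also have "\<dots> = 8 * 2 ^ k * (\<delta> powr \<alpha> * \<Sigma>)"
      by (simp add: \<Sigma>_def algebra_simps)
    also have "\<dots> \<le> 64 * 16 ^ k * (\<delta> powr \<alpha> * \<Sigma>)"
      using pos by (intro mult_right_mono mult_mono power_mono) auto
    finally show ?thesis by (simp add: mult.assoc)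
  qed
  then show ?case by (simp only: defs defs' \<Sigma>_def)
qed

section \<open>Hoelder continuity of the Green integral\<close>

lemma hyp_green_integral_eq_kernel:
  fixes \<psi> :: "'a::euclidean_space \<Rightarrow> 'b::euclidean_space" and \<alpha> :: real
  assumes \<psi>: "\<psi> \<in> borel_measurable (lebesgue_on (ball 0 1))" and x: "x \<in> ball 0 1"
  defines "f \<equiv> \<lambda>y. (1 - (norm y)\<^sup>2) powr (- 1 - \<alpha>) *\<^sub>R \<psi> y"
  shows "integrable ball_tau (\<lambda>y. hyp_green x y *\<^sub>R \<psi> y)
      \<longleftrightarrow> integrable ball_nu (\<lambda>y. hyp_kernel \<alpha> x y *\<^sub>R f y)"
    and "hyp_green_integral \<psi> x = (\<integral>y. hyp_kernel \<alpha> x y *\<^sub>R f y \<partial>ball_nu)"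
    and "(\<lambda>y. hyp_kernel \<alpha> x y *\<^sub>R f y) \<in> borel_measurable ball_nu"
proof -
  define w where "w = (\<lambda>y::'a. 1 / (1 - (norm y)\<^sup>2) ^ DIM('a))"
  note [measurable] = \<psi> id_measurable_lebesgue_on hyp_green_measurable[OF x]
  have meas: "(\<lambda>y. hyp_green x y *\<^sub>R \<psi> y) \<in> borel_measurable ball_nu" "w \<in> borel_measurable ball_nu"
    unfolding w_def by measurable
  have nonneg: "AE y in ball_nu. 0 \<le> w y"
  proof (rule AE_I2)
    fix y :: 'a assume "y \<in> space ball_nu"
    then show "0 \<le> w y" using one_minus_norm_sq_pos[of y] by (simp add: w_def less_imp_le)
  qed
  have eq: "w y *\<^sub>R (hyp_green x y *\<^sub>R \<psi> y) = hyp_kernel \<alpha> x y *\<^sub>R f y" if "y \<in> space ball_nu" for y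
  proof -
    have "0 < 1 - (norm y)\<^sup>2" using that one_minus_norm_sq_pos[of y] by simp
    then have "(1 - (norm y)\<^sup>2) powr (1 + \<alpha>) * (1 - (norm y)\<^sup>2) powr (- 1 - \<alpha>) = 1"
      by (simp flip: powr_add)
    then show ?thesis by (simp add: w_def hyp_kernel_def f_def mult.commute)
  qed
  have tau: "ball_tau = density ball_nu (\<lambda>y. ennreal (w y))"
    by (simp add: ball_tau_def w_def)
  have "integrable ball_tau (\<lambda>y. hyp_green x y *\<^sub>R \<psi> y)
      \<longleftrightarrow> integrable ball_nu (\<lambda>y. w y *\<^sub>R (hyp_green x y *\<^sub>R \<psi> y))"
    unfolding tau by (rule integrable_density[OF meas nonneg])
  also have "\<dots> \<longleftrightarrow> integrable ball_nu (\<lambda>y. hyp_kernel \<alpha> x y *\<^sub>R f y)"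
    using eq by (intro Bochner_Integration.integrable_cong) auto
  finally show "integrable ball_tau (\<lambda>y. hyp_green x y *\<^sub>R \<psi> y)
      \<longleftrightarrow> integrable ball_nu (\<lambda>y. hyp_kernel \<alpha> x y *\<^sub>R f y)" .
  have "hyp_green_integral \<psi> x = (\<integral>y. w y *\<^sub>R (hyp_green x y *\<^sub>R \<psi> y) \<partial>ball_nu)"
    unfolding hyp_green_integral_def tau by (rule integral_density[OF meas nonneg])
  also have "\<dots> = (\<integral>y. hyp_kernel \<alpha> x y *\<^sub>R f y \<partial>ball_nu)"
    using eq by (intro Bochner_Integration.integral_cong) auto
  finally show "hyp_green_integral \<psi> x = (\<integral>y. hyp_kernel \<alpha> x y *\<^sub>R f y \<partial>ball_nu)" .
  have "(\<lambda>y. w y *\<^sub>R (hyp_green x y *\<^sub>R \<psi> y)) \<in> borel_measurable ball_nu"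
    by (rule borel_measurable_scaleR[OF meas(2,1)])
  then show "(\<lambda>y. hyp_kernel \<alpha> x y *\<^sub>R f y) \<in> borel_measurable ball_nu"
    using eq by (subst (asm) measurable_cong) auto
qed

text \<open>The kernel bounds hold off the diagonal, that is, for almost every \<open>y\<close>. Integrating them against
  the \<open>L\<^sup>p\<close> function leaves Riesz potentials, which are bounded uniformly in \<open>x\<close>.\<close>

lemma hyp_green_integral_holder:
  fixes \<psi> :: "'a::euclidean_space \<Rightarrow> 'b::euclidean_space"
  assumes n: "2 \<le> DIM('a)" and \<alpha>: "0 < \<alpha>" "\<alpha> \<le> 1"
    and \<psi>: "\<psi> \<in> borel_measurable (lebesgue_on (ball 0 1))"
    and p: "real DIM('a) < p"
    and Lp: "in_Lp p ball_nu (\<lambda>y. (1 - (norm y)\<^sup>2) powr (- 1 - \<alpha>) *\<^sub>R \<psi> y)"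
  shows "\<And>x. x \<in> ball 0 1 \<Longrightarrow> integrable ball_tau (\<lambda>y. hyp_green x y *\<^sub>R \<psi> y)"
    and "\<exists>C. \<forall>x\<in>ball 0 1. \<forall>x'\<in>ball 0 1.
      norm (hyp_green_integral \<psi> x - hyp_green_integral \<psi> x') \<le> C * norm (x - x') powr \<alpha>"
proof -
  obtain k where k: "DIM('a) = k + 2" using le_Suc_ex[OF n] by (metis add.commute)
  define f where "f = (\<lambda>y. (1 - (norm y)\<^sup>2) powr (- 1 - \<alpha>) *\<^sub>R \<psi> y)"
  obtain M where M: "0 \<le> M"
    and potential: "\<And>x. x \<in> ball 0 1 \<Longrightarrow> integrable ball_nu (\<lambda>y. norm (f y) / norm (x - y) ^ (DIM('a) - 1))"
      "\<And>x. x \<in> ball 0 1 \<Longrightarrow> (\<integral>y. norm (f y) / norm (x - y) ^ (DIM('a) - 1) \<partial>ball_nu) \<le> M"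
    using riesz_potential_bounded[OF n p Lp[folded f_def]] by blast
  define I where "I = (\<lambda>x y. norm (f y) / norm (x - y) ^ Suc k)"
  have I: "integrable ball_nu (I x)" "(\<integral>y. I x y \<partial>ball_nu) \<le> M" if "x \<in> ball 0 1" for x
    using potential[OF that] by (simp_all add: I_def k)
  have kernel: "integrable ball_tau (\<lambda>y. hyp_green x y *\<^sub>R \<psi> y)
      \<longleftrightarrow> integrable ball_nu (\<lambda>y. hyp_kernel \<alpha> x y *\<^sub>R f y)"
    "hyp_green_integral \<psi> x = (\<integral>y. hyp_kernel \<alpha> x y *\<^sub>R f y \<partial>ball_nu)"
    "(\<lambda>y. hyp_kernel \<alpha> x y *\<^sub>R f y) \<in> borel_measurable ball_nu" if "x \<in> ball 0 1" for x
    using hyp_green_integral_eq_kernel[OF \<psi> that, of \<alpha>] by (simp_all only: f_def)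
  have int: "integrable ball_nu (\<lambda>y. hyp_kernel \<alpha> x y *\<^sub>R f y)" if x: "x \<in> ball 0 1" for x
  proof (rule Bochner_Integration.integrable_bound)
    let ?c = "2 ^ Suc k * (1 - (norm x)\<^sup>2) powr \<alpha>"
    show "integrable ball_nu (\<lambda>y. ?c * I x y)" using I(1)[OF x] by simp
    show "AE y in ball_nu. norm (hyp_kernel \<alpha> x y *\<^sub>R f y) \<le> norm (?c * I x y)"
      using AE_ball_nu_not_singleton[of x] AE_space
    proof eventually_elim
      case (elim y)
      then have "\<bar>hyp_kernel \<alpha> x y\<bar> * norm (f y) \<le> ?c / norm (x - y) ^ Suc k * norm (f y)"
        using hyp_kernel_le[OF k x _ _ \<alpha>, of y] by (intro mult_right_mono) auto
      also have "\<dots> = ?c * I x y" by (simp add: I_def)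
      finally show ?case by (simp add: abs_mult I_def)
    qed
  qed (rule kernel(3)[OF x])
  show "integrable ball_tau (\<lambda>y. hyp_green x y *\<^sub>R \<psi> y)" if "x \<in> ball 0 1" for x
    using int[OF that] kernel(1)[OF that] by blast
  define C where "C = (64 * 16 ^ k :: real)"
  show "\<exists>C. \<forall>x\<in>ball 0 1. \<forall>x'\<in>ball 0 1.
      norm (hyp_green_integral \<psi> x - hyp_green_integral \<psi> x') \<le> C * norm (x - x') powr \<alpha>"
  proof (intro exI ballI)
    fix x x' :: 'a assume x: "x \<in> ball 0 1" and x': "x' \<in> ball 0 1"
    let ?\<delta> = "norm (x - x') powr \<alpha>"
    have diff: "integrable ball_nu (\<lambda>y. hyp_kernel \<alpha> x y *\<^sub>R f y - hyp_kernel \<alpha> x' y *\<^sub>R f y)"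
      using int x x' by simp
    have "norm (hyp_green_integral \<psi> x - hyp_green_integral \<psi> x')
        = norm (\<integral>y. (hyp_kernel \<alpha> x y *\<^sub>R f y - hyp_kernel \<alpha> x' y *\<^sub>R f y) \<partial>ball_nu)"
      using int x x' by (simp add: kernel(2))
    also have "\<dots> \<le> (\<integral>y. norm (hyp_kernel \<alpha> x y *\<^sub>R f y - hyp_kernel \<alpha> x' y *\<^sub>R f y) \<partial>ball_nu)"
      by (rule integral_norm_bound)
    also have "\<dots> \<le> (\<integral>y. C * ?\<delta> * (I x y + I x' y) \<partial>ball_nu)"
    proof (rule integral_mono_AE)
      show "integrable ball_nu (\<lambda>y. norm (hyp_kernel \<alpha> x y *\<^sub>R f y - hyp_kernel \<alpha> x' y *\<^sub>R f y))"
        using diff by (rule integrable_norm)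
      show "integrable ball_nu (\<lambda>y. C * ?\<delta> * (I x y + I x' y))"
        using I(1) x x' by simp
      show "AE y in ball_nu. norm (hyp_kernel \<alpha> x y *\<^sub>R f y - hyp_kernel \<alpha> x' y *\<^sub>R f y)
          \<le> C * ?\<delta> * (I x y + I x' y)"
        using AE_ball_nu_not_singleton[of x] AE_ball_nu_not_singleton[of x'] AE_space
      proof eventually_elim
        case (elim y)
        have "norm (hyp_kernel \<alpha> x y *\<^sub>R f y - hyp_kernel \<alpha> x' y *\<^sub>R f y)
            = \<bar>hyp_kernel \<alpha> x y - hyp_kernel \<alpha> x' y\<bar> * norm (f y)"
          by (simp flip: scaleR_diff_left)
        also have "\<dots> \<le> C * ?\<delta> * (1 / norm (x - y) ^ Suc k + 1 / norm (x' - y) ^ Suc k) * norm (f y)"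
          unfolding C_def using hyp_kernel_holder[OF k x x' _ _ _ \<alpha>, of y] elim
          by (intro mult_right_mono) auto
        also have "\<dots> = C * ?\<delta> * (I x y + I x' y)" by (simp add: I_def algebra_simps)
        finally show ?case .
      qed
    qed
    also have "\<dots> = C * ?\<delta> * ((\<integral>y. I x y \<partial>ball_nu) + (\<integral>y. I x' y \<partial>ball_nu))"
      using I(1) x x' by simp
    also have "\<dots> \<le> C * ?\<delta> * (M + M)"
      using I(2) x x' by (intro mult_left_mono add_mono) (auto simp: C_def)
    finally show "norm (hyp_green_integral \<psi> x - hyp_green_integral \<psi> x') \<le> C * (M + M) * ?\<delta>"
      by (simp add: mult_ac)
  qed
qed

theorem proposition4p6:
  fixes \<psi> :: "real ^ 'n \<Rightarrow> real ^ 'm" and \<alpha> p :: real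
  assumes "CARD('n) \<ge> 2"
    and "0 < \<alpha>" and "\<alpha> \<le> 1"
    and "\<psi> \<in> borel_measurable (lebesgue_on (ball 0 1))"
    and "p > real CARD('n)"
    and "in_Lp p ball_nu (\<lambda>y. (1 - (norm y)\<^sup>2) powr (- 1 - \<alpha>) *\<^sub>R \<psi> y)"
  shows "(\<forall>x\<in>ball 0 1. integrable ball_tau (\<lambda>y. hyp_green x y *\<^sub>R \<psi> y)) \<and>
    (\<exists>C. \<forall>x\<in>ball 0 1. \<forall>x'\<in>ball 0 1.
      norm (hyp_green_integral \<psi> x - hyp_green_integral \<psi> x') \<le> C * norm (x - x') powr \<alpha>)"
  using hyp_green_integral_holder[of \<alpha> \<psi> p] assms by simp

end
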